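(* Let $S$ be a semiring, let $M$ and $N$ be $S$-semimodules, let $X\subseteq M$ and $Y\subseteq N$ be (non-empty) sets of generators for $M$ and $N$ respectively, and let $\pi:S^{(X)}\to M$ and $\pi':S^{(Y)}\to N$ be the canonical quotient morphisms. Then, for any $S$-semimodule homomorphism $h:M\to N$, there exists $k\in S^{X\times(Y)}$ such that $h\circ\pi=\pi'\circ h_k$.
   Context: A semiring $\langle S,+,\cdot,0,1\rangle$: $\langle S,+,0\rangle$ is a commutative monoid, $\langle S,\cdot,1\rangle$ is a monoid, $\cdot$ distributes over $+$ from both sides, and $0\cdot a=0=a\cdot 0$ for all $a$. A (left) $S$-semimodule is a commutative monoid $\langle M,+,0\rangle$ with a scalar multiplication $S\times M\to M$ such that $(ab)x=a(bx)$, $a(x+y)=ax+ay$, $(a+b)x=ax+bx$, $0_S x=0_M=a0_M$, $1x=x$. The statement is written for left semimodules; the right-handed version is its mirror image. Homomorphisms preserve sums and scalar multiplication. $X$ generates $M$ if every element of $M$ is a finite linear combination of elements of $X$ with coefficients in $S$. $S^{(X)}$ is the free $S$-semimodule over $X$: the functions $X\to S$ with finite support, with pointwise operations; $\chi_x\in S^{(X)}$ is the function with value $1$ at $x$ and $0_S$ elsewhere. The canonical quotient morphism $\pi:S^{(X)}\to M$ is the unique homomorphism with $\pi(\chi_x)=x$ for all $x\in X$, i.e. $\pi(f)=\sum_{x\in X}f(x)\cdot x$; similarly for $\pi'$. $S^{X\times(Y)}$ is the set of functions $k:X\times Y\to S$ such that $k(x,-)\in S^{(Y)}$ for every $x\in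 X$. For such $k$, $h_k:S^{(X)}\to S^{(Y)}$ is the homomorphism $h_k(f)=\sum_{x\in X}f(x)\,k(x,-)$. *)

theory Defs
  imports "HOL-Algebra.Module"
begin

text \<open>Left semimodules, as objects in the style of HOL-Algebra. As for \<^locale>\<open>module\<close>, the
  record type of a semimodule carries the fields \<^const>\<open>mult\<close> and \<^const>\<open>one\<close>, which play no
  role.\<close>

locale semimodule = R?: semiring + M?: abelian_monoid M for M (structure) +
  assumes smult_closed [simp, intro]:
      "\<lbrakk>a \<in> carrier R; x \<in> carrier M\<rbrakk> \<Longrightarrow> a \<odot>\<^bsub>M\<^esub> x \<in> carrier M"
    and smult_assoc:
      "\<lbrakk>a \<in> carrier R; b \<in> carrier R; x \<in> carrier M\<rbrakk> \<Longrightarrow>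
        (a \<otimes> b) \<odot>\<^bsub>M\<^esub> x = a \<odot>\<^bsub>M\<^esub> (b \<odot>\<^bsub>M\<^esub> x)"
    and smult_r_distr:
      "\<lbrakk>a \<in> carrier R; x \<in> carrier M; y \<in> carrier M\<rbrakk> \<Longrightarrow>
        a \<odot>\<^bsub>M\<^esub> (x \<oplus>\<^bsub>M\<^esub> y) = a \<odot>\<^bsub>M\<^esub> x \<oplus>\<^bsub>M\<^esub> a \<odot>\<^bsub>M\<^esub> y"
    and smult_l_distr:
      "\<lbrakk>a \<in> carrier R; b \<in> carrier R; x \<in> carrier M\<rbrakk> \<Longrightarrow>
        (a \<oplus> b) \<odot>\<^bsub>M\<^esub> x = a \<odot>\<^bsub>M\<^esub> x \<oplus>\<^bsub>M\<^esub> b \<odot>\<^bsub>M\<^esub> x"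
    and smult_l_null [simp]: "x \<in> carrier M \<Longrightarrow> \<zero> \<odot>\<^bsub>M\<^esub> x = \<zero>\<^bsub>M\<^esub>"
    and smult_r_null [simp]: "a \<in> carrier R \<Longrightarrow> a \<odot>\<^bsub>M\<^esub> \<zero>\<^bsub>M\<^esub> = \<zero>\<^bsub>M\<^esub>"
    and smult_one [simp]: "x \<in> carrier M \<Longrightarrow> \<one> \<odot>\<^bsub>M\<^esub> x = x"

definition semimodule_hom ::
  "('s, 'r) ring_scheme \<Rightarrow> ('s, 'a, 'm) module_scheme \<Rightarrow> ('s, 'b, 'n) module_scheme \<Rightarrow> ('a \<Rightarrow> 'b) set"
  where "semimodule_hom S M N =
    {h \<in> carrier M \<rightarrow> carrier N.
      (\<forall>x\<in>carrier M. \<forall>y\<in>carrier M. h (x \<oplus>\<^bsub>M\<^esub> y) = h x \<oplus>\<^bsub>N\<^esub> h y) \<and>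
      (\<forall>a\<in>carrier S. \<forall>x\<in>carrier M. h (a \<odot>\<^bsub>M\<^esub> x) = a \<odot>\<^bsub>N\<^esub> h x)}"

definition generates :: "('s, 'r) ring_scheme \<Rightarrow> ('s, 'a, 'm) module_scheme \<Rightarrow> 'a set \<Rightarrow> bool"
  where "generates S M X \<longleftrightarrow> X \<subseteq> carrier M \<and>
    (\<forall>m\<in>carrier M. \<exists>A c. finite A \<and> A \<subseteq> X \<and> c \<in> A \<rightarrow> carrier S \<and>
      m = (\<Oplus>\<^bsub>M\<^esub>x\<in>A. c x \<odot>\<^bsub>M\<^esub> x))"

definition supp :: "('s, 'r) ring_scheme \<Rightarrow> 'x set \<Rightarrow> ('x \<Rightarrow> 's) \<Rightarrow> 'x set"
  where "supp S X f = {x \<in> X. f x \<noteq> \<zero>\<^bsub>S\<^esub>}"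

text \<open>The free semimodule \<open>S\<^sup>(\<^sup>X\<^sup>)\<close>. Functions on \<open>X\<close> are extensional (equal to \<^const>\<open>undefined\<close> off
  \<open>X\<close>), so that they are equal iff they agree on \<open>X\<close>.\<close>

definition free_semimodule :: "('s, 'r) ring_scheme \<Rightarrow> 'x set \<Rightarrow> ('s, 'x \<Rightarrow> 's) module"
  where "free_semimodule S X =
    \<lparr>carrier = {f \<in> X \<rightarrow>\<^sub>E carrier S. finite (supp S X f)},
     mult = undefined, one = undefined,
     zero = (\<lambda>x\<in>X. \<zero>\<^bsub>S\<^esub>),
     add = (\<lambda>f g. \<lambda>x\<in>X. f x \<oplus>\<^bsub>S\<^esub> g x),
     smult = (\<lambda>a f. \<lambda>x\<in>X. a \<otimes>\<^bsub>S\<^esub> f x)\<rparr>"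

definition chi :: "('s, 'r) ring_scheme \<Rightarrow> 'x set \<Rightarrow> 'x \<Rightarrow> 'x \<Rightarrow> 's"
  where "chi S X x = (\<lambda>y\<in>X. if y = x then \<one>\<^bsub>S\<^esub> else \<zero>\<^bsub>S\<^esub>)"

text \<open>Sums over \<open>X\<close> are taken over the support of \<open>f\<close>, since \<^const>\<open>finsum\<close> over an infinite index
  set is zero by convention. That \<open>canonical_map\<close> is the unique homomorphism sending each \<open>\<chi>\<^sub>x\<close> to
  \<open>x\<close> is proved below.\<close>

definition canonical_map ::
  "('s, 'r) ring_scheme \<Rightarrow> ('s, 'a, 'm) module_scheme \<Rightarrow> 'a set \<Rightarrow> ('a \<Rightarrow> 's) \<Rightarrow> 'a"
  where "canonical_map S M X f = (\<Oplus>\<^bsub>M\<^esub>x\<in>supp S X f. f x \<odot>\<^bsub>M\<^esub> x)"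

definition row :: "'y set \<Rightarrow> ('x \<times> 'y \<Rightarrow> 's) \<Rightarrow> 'x \<Rightarrow> 'y \<Rightarrow> 's"
  where "row Y k x = (\<lambda>y\<in>Y. k (x, y))"

definition row_finite :: "('s, 'r) ring_scheme \<Rightarrow> 'x set \<Rightarrow> 'y set \<Rightarrow> ('x \<times> 'y \<Rightarrow> 's) set"
  where "row_finite S X Y =
    {k \<in> X \<times> Y \<rightarrow>\<^sub>E carrier S. \<forall>x\<in>X. row Y k x \<in> carrier (free_semimodule S Y)}"

definition matrix_hom ::
  "('s, 'r) ring_scheme \<Rightarrow> 'x set \<Rightarrow> 'y set \<Rightarrow> ('x \<times> 'y \<Rightarrow> 's) \<Rightarrow> ('x \<Rightarrow> 's) \<Rightarrow> ('y \<Rightarrow> 's)"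
  where "matrix_hom S X Y k f =
    (\<Oplus>\<^bsub>free_semimodule S Y\<^esub>x\<in>supp S X f. f x \<odot>\<^bsub>free_semimodule S Y\<^esub> row Y k x)"

lemma free_semimodule_simps:
  "carrier (free_semimodule S X) = {f \<in> X \<rightarrow>\<^sub>E carrier S. finite (supp S X f)}"
  "\<zero>\<^bsub>free_semimodule S X\<^esub> = (\<lambda>x\<in>X. \<zero>\<^bsub>S\<^esub>)"
  "f \<oplus>\<^bsub>free_semimodule S X\<^esub> g = (\<lambda>x\<in>X. f x \<oplus>\<^bsub>S\<^esub> g x)"
  "a \<odot>\<^bsub>free_semimodule S X\<^esub> f = (\<lambda>x\<in>X. a \<otimes>\<^bsub>S\<^esub> f x)"
  by (simp_all add: free_semimodule_def)

lemma (in semiring) semimodule_free: "semimodule R (free_semimodule R X)"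
proof -
  let ?F = "free_semimodule R X"
  have clos_add: "f \<oplus>\<^bsub>?F\<^esub> g \<in> carrier ?F" if "f \<in> carrier ?F" "g \<in> carrier ?F" for f g
  proof -
    have "supp R X (f \<oplus>\<^bsub>?F\<^esub> g) \<subseteq> supp R X f \<union> supp R X g"
      by (auto simp: supp_def free_semimodule_simps)
    then show ?thesis using that
      by (auto simp: free_semimodule_simps PiE_iff intro: finite_subset)
  qed
  have clos_smult: "a \<odot>\<^bsub>?F\<^esub> f \<in> carrier ?F" if "a \<in> carrier R" "f \<in> carrier ?F" for a f
  proof -
    have "supp R X (a \<odot>\<^bsub>?F\<^esub> f) \<subseteq> supp R X f"
      using that by (auto simp: supp_def free_semimodule_simps)
    then show ?thesis using that
      by (auto simp: free_semimodule_simps PiE_iff intro: finite_subset)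
  qed
  have clos_zero: "\<zero>\<^bsub>?F\<^esub> \<in> carrier ?F"
    by (auto simp: free_semimodule_simps supp_def)
  have am: "abelian_monoid ?F"
    by (rule abelian_monoidI)
       (use clos_add clos_zero in \<open>auto simp: free_semimodule_simps PiE_iff a_ac extensional_def fun_eq_iff\<close>)
  show ?thesis
    by (intro semimodule.intro semimodule_axioms.intro semiring_axioms am)
       (use clos_smult in \<open>auto simp: free_semimodule_simps PiE_iff m_assoc l_distr r_distr
          extensional_def fun_eq_iff\<close>)
qed

context semimodule
begin

lemma canonical_map_alt:
  assumes "X \<subseteq> carrier M" "finite A" "supp R X f \<subseteq> A" "A \<subseteq> X" "f \<in> X \<rightarrow> carrier R"
  shows "canonical_map R M X f = (\<Oplus>\<^bsub>M\<^esub>x\<in>A. f x \<odot>\<^bsub>M\<^esub> x)"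
  unfolding canonical_map_def
proof (rule M.add.finprod_mono_neutral_cong_left)
  show "(\<lambda>x. f x \<odot>\<^bsub>M\<^esub> x) \<in> A \<rightarrow> carrier M"
    using assms by (auto intro!: smult_closed)
qed (use assms in \<open>auto simp: supp_def\<close>)

lemma canonical_map_hom:
  assumes X: "X \<subseteq> carrier M"
  shows "canonical_map R M X \<in> semimodule_hom R (free_semimodule R X) M"
proof -
  let ?F = "free_semimodule R X"
  interpret F: semimodule R ?F by (rule R.semimodule_free)
  have car: "f \<in> X \<rightarrow> carrier R" "finite (supp R X f)" if "f \<in> carrier ?F" for f
    using that by (auto simp: free_semimodule_simps)
  have XM: "x \<in> carrier M" if "x \<in> X" for x using that X by auto
  have closed: "canonical_map R M X f \<in> carrier M" if "f \<in> carrier ?F" for f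
    unfolding canonical_map_def
    using car[OF that] XM by (intro M.finsum_closed) (auto simp: supp_def)
  have add: "canonical_map R M X (f \<oplus>\<^bsub>?F\<^esub> g) = canonical_map R M X f \<oplus>\<^bsub>M\<^esub> canonical_map R M X g"
    if f: "f \<in> carrier ?F" and g: "g \<in> carrier ?F" for f g
  proof -
    let ?A = "supp R X f \<union> supp R X g"
    have A: "finite ?A" "?A \<subseteq> X" using car f g by (auto simp: supp_def)
    have fg: "f x \<in> carrier R" "g x \<in> carrier R" "x \<in> carrier M" if "x \<in> ?A" for x
      using that A car f g XM by blast+
    have "canonical_map R M X (f \<oplus>\<^bsub>?F\<^esub> g) = (\<Oplus>\<^bsub>M\<^esub>x\<in>?A. (f \<oplus>\<^bsub>?F\<^esub> g) x \<odot>\<^bsub>M\<^esub> x)"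
      using A car[OF F.a_closed[OF f g]]
      by (intro canonical_map_alt X) (auto simp: supp_def free_semimodule_simps)
    also have "\<dots> = (\<Oplus>\<^bsub>M\<^esub>x\<in>?A. f x \<odot>\<^bsub>M\<^esub> x \<oplus>\<^bsub>M\<^esub> g x \<odot>\<^bsub>M\<^esub> x)"
      using fg A by (intro M.finsum_cong') (auto simp: free_semimodule_simps smult_l_distr)
    also have "\<dots> = (\<Oplus>\<^bsub>M\<^esub>x\<in>?A. f x \<odot>\<^bsub>M\<^esub> x) \<oplus>\<^bsub>M\<^esub> (\<Oplus>\<^bsub>M\<^esub>x\<in>?A. g x \<odot>\<^bsub>M\<^esub> x)"
      using fg by (intro M.finsum_addf) auto
    also have "\<dots> = canonical_map R M X f \<oplus>\<^bsub>M\<^esub> canonical_map R M X g"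
      using A car f g X by (simp add: canonical_map_alt[of X ?A])
    finally show ?thesis .
  qed
  have smult_sum: "a \<odot>\<^bsub>M\<^esub> (\<Oplus>\<^bsub>M\<^esub>x\<in>A. g x) = (\<Oplus>\<^bsub>M\<^esub>x\<in>A. a \<odot>\<^bsub>M\<^esub> g x)"
    if "finite A" "a \<in> carrier R" "g \<in> A \<rightarrow> carrier M" for a g and A :: "'c set"
    using that by (induction A) (auto simp: smult_r_distr Pi_iff)
  have smult: "canonical_map R M X (a \<odot>\<^bsub>?F\<^esub> f) = a \<odot>\<^bsub>M\<^esub> canonical_map R M X f"
    if a: "a \<in> carrier R" and f: "f \<in> carrier ?F" for a f
  proof -
    let ?A = "supp R X f"
    have A: "finite ?A" "?A \<subseteq> X" using car f by (auto simp: supp_def)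
    have fx: "f x \<in> carrier R" "x \<in> carrier M" if "x \<in> ?A" for x
      using that A car f XM by blast+
    have "canonical_map R M X (a \<odot>\<^bsub>?F\<^esub> f) = (\<Oplus>\<^bsub>M\<^esub>x\<in>?A. (a \<odot>\<^bsub>?F\<^esub> f) x \<odot>\<^bsub>M\<^esub> x)"
      using A a car[OF F.smult_closed[OF a f]]
      by (intro canonical_map_alt X) (auto simp: supp_def free_semimodule_simps)
    also have "\<dots> = (\<Oplus>\<^bsub>M\<^esub>x\<in>?A. a \<odot>\<^bsub>M\<^esub> (f x \<odot>\<^bsub>M\<^esub> x))"
      using fx a A by (intro M.finsum_cong') (auto simp: free_semimodule_simps smult_assoc)
    also have "\<dots> = a \<odot>\<^bsub>M\<^esub> (\<Oplus>\<^bsub>M\<^esub>x\<in>?A. f x \<odot>\<^bsub>M\<^esub> x)"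
      using fx a A by (intro smult_sum[symmetric]) auto
    finally show ?thesis by (simp add: canonical_map_def)
  qed
  show ?thesis
    using closed add smult by (auto simp: semimodule_hom_def)
qed

lemma canonical_map_chi:
  assumes X: "X \<subseteq> carrier M" and x: "x \<in> X"
  shows "canonical_map R M X (chi R X x) = x"
proof -
  have "canonical_map R M X (chi R X x) = (\<Oplus>\<^bsub>M\<^esub>y\<in>{x}. chi R X x y \<odot>\<^bsub>M\<^esub> y)"
    using x by (intro canonical_map_alt X) (auto simp: supp_def chi_def)
  also have "\<dots> = x" using x X by (auto simp: chi_def)
  finally show ?thesis .
qed

end

lemma semimodule_hom_finsum:
  assumes "semimodule S M" "semimodule S N" "h \<in> semimodule_hom S M N"
    and "finite A" "g \<in> A \<rightarrow> carrier M"
  shows "h (\<Oplus>\<^bsub>M\<^esub>x\<in>A. g x) = (\<Oplus>\<^bsub>N\<^esub>x\<in>A. h (g x))"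
proof -
  interpret M: semimodule S M by fact
  interpret N: semimodule S N by fact
  have h: "h x \<in> carrier N" if "x \<in> carrier M" for x
    using assms(3) that by (auto simp: semimodule_hom_def)
  have "h \<zero>\<^bsub>M\<^esub> = h (\<zero>\<^bsub>S\<^esub> \<odot>\<^bsub>M\<^esub> \<zero>\<^bsub>M\<^esub>)" by simp
  also have "\<dots> = \<zero>\<^bsub>S\<^esub> \<odot>\<^bsub>N\<^esub> h \<zero>\<^bsub>M\<^esub>"
    using assms(3) M.M.zero_closed M.R.zero_closed unfolding semimodule_hom_def by blast
  also have "\<dots> = \<zero>\<^bsub>N\<^esub>" using h by simp
  finally have h0: "h \<zero>\<^bsub>M\<^esub> = \<zero>\<^bsub>N\<^esub>" .
  have ha: "h (x \<oplus>\<^bsub>M\<^esub> y) = h x \<oplus>\<^bsub>N\<^esub> h y" if "x \<in> carrier M" "y \<in> carrier M" for x y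
    using assms(3) that by (auto simp: semimodule_hom_def)
  show ?thesis using assms(4,5)
    by (induction A) (auto simp: h0 ha h Pi_iff)
qed

lemma (in semiring) chi_closed: "x \<in> X \<Longrightarrow> chi R X x \<in> carrier (free_semimodule R X)"
proof -
  assume "x \<in> X"
  have "supp R X (chi R X x) \<subseteq> {x}" by (auto simp: supp_def chi_def)
  then show ?thesis by (auto simp: free_semimodule_simps chi_def intro: finite_subset)
qed

lemma (in semiring) free_semimodule_decomp:
  assumes f: "f \<in> carrier (free_semimodule R X)"
  shows "f = (\<Oplus>\<^bsub>free_semimodule R X\<^esub>x\<in>supp R X f. f x \<odot>\<^bsub>free_semimodule R X\<^esub> chi R X x)"
    (is "f = ?g")
proof -
  let ?F = "free_semimodule R X"
  interpret F: semimodule R ?F by (rule semimodule_free)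
  have fR: "f x \<in> carrier R" if "x \<in> X" for x using f that by (auto simp: free_semimodule_simps)
  have term_closed: "f x \<odot>\<^bsub>?F\<^esub> chi R X x \<in> carrier ?F" if "x \<in> X" for x
    using that by (intro F.smult_closed fR chi_closed)
  have g: "?g \<in> carrier ?F"
    using term_closed by (intro F.M.finsum_closed) (auto simp: supp_def)
  have chi_at: "chi R X x y = (if y = x then \<one> else \<zero>)" if "y \<in> X" for x y
    using that by (simp add: chi_def)
  have sum: "(\<Oplus>\<^bsub>?F\<^esub>x\<in>A. f x \<odot>\<^bsub>?F\<^esub> chi R X x) y = (if y \<in> A then f y else \<zero>)"
    if "finite A" "A \<subseteq> X" "y \<in> X" for A y
    using that
  proof (induction A)
    case empty
    then show ?case by (simp add: free_semimodule_simps)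
  next
    case (insert x A)
    then have "(\<Oplus>\<^bsub>?F\<^esub>x\<in>insert x A. f x \<odot>\<^bsub>?F\<^esub> chi R X x)
        = f x \<odot>\<^bsub>?F\<^esub> chi R X x \<oplus>\<^bsub>?F\<^esub> (\<Oplus>\<^bsub>?F\<^esub>x\<in>A. f x \<odot>\<^bsub>?F\<^esub> chi R X x)"
      using term_closed by (intro F.M.finsum_insert) auto
    then have "(\<Oplus>\<^bsub>?F\<^esub>x\<in>insert x A. f x \<odot>\<^bsub>?F\<^esub> chi R X x) y
        = f x \<otimes> chi R X x y \<oplus> (\<Oplus>\<^bsub>?F\<^esub>x\<in>A. f x \<odot>\<^bsub>?F\<^esub> chi R X x) y"
      using insert.prems by (simp only: free_semimodule_simps(3,4) restrict_apply simp_thms if_True)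
    also have "\<dots> = f x \<otimes> (if y = x then \<one> else \<zero>) \<oplus> (if y \<in> A then f y else \<zero>)"
      using insert.IH insert.prems chi_at by simp
    also have "\<dots> = (if y \<in> insert x A then f y else \<zero>)"
      using insert.hyps insert.prems fR by auto
    finally show ?case .
  qed
  show ?thesis
  proof (rule extensionalityI[of _ X])
    show "f \<in> extensional X" "?g \<in> extensional X"
      using f g by (auto simp: free_semimodule_simps PiE_iff)
    show "f y = ?g y" if "y \<in> X" for y
      using sum[of "supp R X f" y] f that by (auto simp: free_semimodule_simps supp_def)
  qed
qed

lemma (in semimodule) canonical_map_unique:
  assumes X: "X \<subseteq> carrier M" and p: "p \<in> semimodule_hom R (free_semimodule R X) M"
    and chi: "\<And>x. x \<in> X \<Longrightarrow> p (chi R X x) = x" and f: "f \<in> carrier (free_semimodule R X)"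
  shows "p f = canonical_map R M X f"
proof -
  let ?F = "free_semimodule R X"
  interpret F: semimodule R ?F by (rule R.semimodule_free)
  have fR: "f x \<in> carrier R" if "x \<in> supp R X f" for x
    using f that by (auto simp: free_semimodule_simps supp_def)
  have X': "x \<in> X" if "x \<in> supp R X f" for x using that by (auto simp: supp_def)
  have "p f = p (\<Oplus>\<^bsub>?F\<^esub>x\<in>supp R X f. f x \<odot>\<^bsub>?F\<^esub> chi R X x)"
    using R.free_semimodule_decomp[OF f] by simp
  also have "\<dots> = (\<Oplus>\<^bsub>M\<^esub>x\<in>supp R X f. p (f x \<odot>\<^bsub>?F\<^esub> chi R X x))"
  proof (rule semimodule_hom_finsum[OF F.semimodule_axioms semimodule_axioms p])
    show "finite (supp R X f)" using f by (simp add: free_semimodule_simps)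
    show "(\<lambda>x. f x \<odot>\<^bsub>?F\<^esub> chi R X x) \<in> supp R X f \<rightarrow> carrier ?F"
      by (intro Pi_I F.smult_closed fR R.chi_closed X')
  qed
  also have "\<dots> = (\<Oplus>\<^bsub>M\<^esub>x\<in>supp R X f. f x \<odot>\<^bsub>M\<^esub> x)"
  proof (rule M.finsum_cong')
    show "(\<lambda>x. f x \<odot>\<^bsub>M\<^esub> x) \<in> supp R X f \<rightarrow> carrier M"
      using X X' by (intro Pi_I smult_closed fR) auto
    show "p (f x \<odot>\<^bsub>?F\<^esub> chi R X x) = f x \<odot>\<^bsub>M\<^esub> x" if "x \<in> supp R X f" for x
      using p fR[OF that] R.chi_closed[OF X'[OF that]] chi[OF X'[OF that]]
      by (simp add: semimodule_hom_def)
  qed simp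
  finally show ?thesis by (simp add: canonical_map_def)
qed

end

theory Submission
  imports Defs
begin

text \<open>This is the lifting property of free semimodules, applied to the canonical quotient
  \<open>\<pi>'\<close>. Since \<open>Y\<close> generates \<open>N\<close>, \<open>\<pi>'\<close> is onto (\<open>canonical_map_surj\<close>), so each \<open>h x\<close> with
  \<open>x \<in> X\<close> has a preimage in \<open>S\<^sup>(\<^sup>Y\<^sup>)\<close>; these preimages, chosen arbitrarily, are the rows of \<open>k\<close>.
  Both \<open>h \<circ> \<pi>\<close> and \<open>\<pi>' \<circ> h\<^sub>k\<close> then send \<open>f\<close> to the linear combination of the \<open>h x\<close> with
  coefficients \<open>f x\<close>, because homomorphisms commute with finite linear combinations
  (\<open>semimodule_hom_lincomb\<close>).\<close>

lemma semimodule_hom_lincomb: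
  assumes M: "semimodule S M" and N: "semimodule S N" and p: "p \<in> semimodule_hom S M N"
    and A: "finite A" "c \<in> A \<rightarrow> carrier S" "v \<in> A \<rightarrow> carrier M"
  shows "p (\<Oplus>\<^bsub>M\<^esub>x\<in>A. c x \<odot>\<^bsub>M\<^esub> v x) = (\<Oplus>\<^bsub>N\<^esub>x\<in>A. c x \<odot>\<^bsub>N\<^esub> p (v x))"
proof -
  interpret M: semimodule S M by (rule M)
  interpret N: semimodule S N by (rule N)
  have "p (\<Oplus>\<^bsub>M\<^esub>x\<in>A. c x \<odot>\<^bsub>M\<^esub> v x) = (\<Oplus>\<^bsub>N\<^esub>x\<in>A. p (c x \<odot>\<^bsub>M\<^esub> v x))"
    using A by (intro semimodule_hom_finsum[OF M N p]) (auto simp: Pi_iff)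
  also have "\<dots> = (\<Oplus>\<^bsub>N\<^esub>x\<in>A. c x \<odot>\<^bsub>N\<^esub> p (v x))"
    using A p by (intro N.M.finsum_cong') (auto simp: semimodule_hom_def Pi_iff)
  finally show ?thesis .
qed

text \<open>A linear combination of finitely many generators becomes an element of the free semimodule
  once its coefficients are extended by zero to all of \<open>X\<close>.\<close>

lemma (in semimodule) canonical_map_surj:
  assumes gen: "generates R M X" and m: "m \<in> carrier M"
  obtains g where "g \<in> carrier (free_semimodule R X)" "canonical_map R M X g = m"
proof -
  from gen m obtain A c where A: "finite A" "A \<subseteq> X" "c \<in> A \<rightarrow> carrier R"
    and m_eq: "m = (\<Oplus>\<^bsub>M\<^esub>x\<in>A. c x \<odot>\<^bsub>M\<^esub> x)"
    unfolding generates_def by blast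
  have X: "X \<subseteq> carrier M" using gen by (simp add: generates_def)
  define g where "g = (\<lambda>x\<in>X. if x \<in> A then c x else \<zero>)"
  have supp: "supp R X g \<subseteq> A" by (auto simp: supp_def g_def)
  have gR: "g \<in> X \<rightarrow>\<^sub>E carrier R" using A(3) by (auto simp: g_def)
  have "g \<in> carrier (free_semimodule R X)"
    using gR finite_subset[OF supp A(1)] by (simp add: free_semimodule_simps)
  moreover have "canonical_map R M X g = (\<Oplus>\<^bsub>M\<^esub>x\<in>A. g x \<odot>\<^bsub>M\<^esub> x)"
    using gR by (intro canonical_map_alt X A supp) auto
  then have "canonical_map R M X g = m"
    unfolding m_eq using A X
    by (auto simp: g_def Pi_iff subset_iff intro!: M.finsum_cong')
  ultimately show thesis by (rule that)
qed

theorem theorem2p16: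
  fixes S :: "('s, 'r) ring_scheme"
    and M :: "('s, 'a, 'm) module_scheme"
    and N :: "('s, 'b, 'n) module_scheme"
    and X :: "'a set" and Y :: "'b set" and h :: "'a \<Rightarrow> 'b"
  assumes "semiring S" "semimodule S M" "semimodule S N"
    and "X \<subseteq> carrier M" "X \<noteq> {}" "generates S M X"
    and "Y \<subseteq> carrier N" "Y \<noteq> {}" "generates S N Y"
    and "h \<in> semimodule_hom S M N"
  shows "\<exists>k\<in>row_finite S X Y. \<forall>f\<in>carrier (free_semimodule S X).
           (h \<circ> canonical_map S M X) f = (canonical_map S N Y \<circ> matrix_hom S X Y k) f"
proof -
  interpret M: semimodule S M by fact
  interpret N: semimodule S N by fact
  let ?F = "free_semimodule S Y"
  have F: "semimodule S ?F" by (rule M.R.semimodule_free)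
  have hom: "canonical_map S N Y \<in> semimodule_hom S ?F N"
    by (rule N.canonical_map_hom) fact
  have hN: "h x \<in> carrier N" if "x \<in> X" for x
    using assms(4,10) that by (auto simp: semimodule_hom_def)
  have "\<exists>g. g \<in> carrier ?F \<and> canonical_map S N Y g = h x" if "x \<in> X" for x
    using N.canonical_map_surj[OF assms(9) hN[OF that]] by metis
  then obtain g where g: "g x \<in> carrier ?F" "canonical_map S N Y (g x) = h x"
    if "x \<in> X" for x by metis
  define k where "k = (\<lambda>(x, y)\<in>X \<times> Y. g x y)"
  have row: "row Y k x = g x" if "x \<in> X" for x
    using g(1)[OF that] that
    by (auto simp: row_def k_def free_semimodule_simps PiE_iff extensional_def fun_eq_iff)
  have k: "k \<in> row_finite S X Y"
    using g(1) row by (auto simp: row_finite_def k_def free_semimodule_simps)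
  have "h (canonical_map S M X f) = canonical_map S N Y (matrix_hom S X Y k f)"
    if f: "f \<in> carrier (free_semimodule S X)" for f
  proof -
    let ?A = "supp S X f"
    have A: "finite ?A" "f \<in> ?A \<rightarrow> carrier S" and AX: "?A \<subseteq> X"
      using f by (auto simp: free_semimodule_simps supp_def)
    have "h (canonical_map S M X f) = (\<Oplus>\<^bsub>N\<^esub>x\<in>?A. f x \<odot>\<^bsub>N\<^esub> h x)"
      unfolding canonical_map_def
      using AX assms(4) by (intro semimodule_hom_lincomb[OF assms(2,3,10)] A) auto
    also have "\<dots> = (\<Oplus>\<^bsub>N\<^esub>x\<in>?A. f x \<odot>\<^bsub>N\<^esub> canonical_map S N Y (row Y k x))"
      using A AX g(2) hN row
      by (intro N.M.finsum_cong') (auto simp: Pi_iff subset_iff)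
    also have "\<dots> = canonical_map S N Y (matrix_hom S X Y k f)"
      unfolding matrix_hom_def
      using AX g(1) row
      by (intro semimodule_hom_lincomb[OF F assms(3) hom, symmetric] A) auto
    finally show ?thesis .
  qed
  with k show ?thesis by auto
qed

end
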